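(* Let $n\ge 3$, $m\ge 3$ and let $\mathcal{S}_{\mathbf W}=\sum_{i=1}^n \mathbf w_i^{\circ m}\in T^m(\mathbb R^{n-1})$ be the regular simplex tensor generated by the regular simplex frame $\mathbf W=(\mathbf w_1,\dots,\mathbf w_n)$. Then for all combinations $(m,n)$ except $(m,n)=(4,3)$, the only locally maximized eigenpairs of $\mathcal S_{\mathbf W}$, considered up to sign equivalence, are those given by the vectors $\mathbf w_1,\dots,\mathbf w_n$ of the regular simplex frame.
   Context: $T^m(\mathbb R^{p})$ is the space of real symmetric tensors of order $m$ and dimension $p$. Regular simplex frame: vectors $\mathbf w_1,\dots,\mathbf w_n\in\mathbb R^{n-1}$ with $\|\mathbf w_i\|=1$, $\mathbf w_i^{\mathrm T}\mathbf w_j=-\frac1{n-1}$ for $i\ne j$, and $\mathbf W\mathbf W^{\mathrm T}=\frac{n}{n-1}\mathbf I_{n-1}$. $\mathbf w_i^{\circ m}$ is the $m$-fold outer power, so $\mathcal S_{\mathbf W}\mathbf v^m=\sum_i(\mathbf w_i^{\mathrm T}\mathbf v)^m$ and $\mathcal S_{\mathbf W}\mathbf v^{m-1}=\sum_i(\mathbf w_i^{\mathrm T}\mathbf v)^{m-1}\mathbf w_i$. Eigenpairs are real (Z-)eigenpairs: $(\lambda,\mathbf v)\in\mathbb R\times\mathbb R^{n-1}$ with $\mathcal S_{\mathbf W}\mathbf v^{m-1}=\lambda\mathbf v$, $\mathbf v^{\mathrm T}\mathbf v=1$; these are the KKT points of $\max\{\mathcal S_{\mathbf W}\mathbf v^m:\mathbf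 v^{\mathrm T}\mathbf v=1\}$. Sign equivalence: $(\lambda,\mathbf v)$ and $((-1)^{m-2}\lambda,-\mathbf v)$ are identified, and a representative with $\lambda\ge 0$ is always chosen (for even $m$ every eigenvalue is $\geq 0$ and $\pm\mathbf v$ are identified). An eigenpair $(\lambda,\mathbf v)$ (chosen with $\lambda\ge0$) is locally maximized if $\mathbf v$ is a local maximizer of $\mathbf v\mapsto\mathcal S_{\mathbf W}\mathbf v^m$ on the unit sphere of $\mathbb R^{n-1}$. *)

theory Defs
  imports "HOL-Analysis.Analysis" "HOL-Library.Multiset"
begin

text \<open>
  A tensor of order m over the index type \<open>'d\<close> is given by its entries, indexed by lists
  of length m; entries at lists of any other length are junk and set to 0.
\<close>

type_synonym 'd tensor = "'d list \<Rightarrow> real"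

definition sym_tensors :: "nat \<Rightarrow> 'd tensor set" where
  "sym_tensors m =
    {A. (\<forall>js. length js \<noteq> m \<longrightarrow> A js = 0) \<and> (\<forall>js ks. mset js = mset ks \<longrightarrow> A js = A ks)}"

definition outer_power :: "nat \<Rightarrow> real ^ 'd \<Rightarrow> 'd tensor" where
  "outer_power m w = (\<lambda>js. if length js = m then (\<Prod>j\<leftarrow>js. w $ j) else 0)"

text \<open>\<open>A v\<^sup>m\<close> and \<open>A v\<^sup>m\<^sup>-\<^sup>1\<close>: contraction with v in all indices, respectively in all but the first.\<close>

definition tensor_form :: "nat \<Rightarrow> ('d::finite) tensor \<Rightarrow> real ^ 'd \<Rightarrow> real" where
  "tensor_form m A v = (\<Sum>js | length js = m. A js * (\<Prod>j\<leftarrow>js. v $ j))"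

definition tensor_contract :: "nat \<Rightarrow> ('d::finite) tensor \<Rightarrow> real ^ 'd \<Rightarrow> real ^ 'd" where
  "tensor_contract m A v = (\<chi> i. \<Sum>js | length js = m - 1. A (i # js) * (\<Prod>j\<leftarrow>js. v $ j))"

text \<open>The frame vectors are the columns of the \<open>(n - 1) \<times> n\<close> matrix W.\<close>

definition regular_simplex_frame :: "real ^ ('n::finite) ^ ('d::finite) \<Rightarrow> bool" where
  "regular_simplex_frame W \<longleftrightarrow>
    CARD('d) = CARD('n) - 1 \<and>
    (\<forall>i. norm (column i W) = 1) \<and>
    (\<forall>i j. i \<noteq> j \<longrightarrow> column i W \<bullet> column j W = - 1 / (real CARD('n) - 1)) \<and>
    W ** transpose W = (real CARD('n) / (real CARD('n) - 1)) *\<^sub>R mat 1"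

definition simplex_tensor :: "nat \<Rightarrow> real ^ ('n::finite) ^ ('d::finite) \<Rightarrow> 'd tensor" where
  "simplex_tensor m W = (\<lambda>js. \<Sum>i\<in>UNIV. outer_power m (column i W) js)"

definition eigenpair :: "nat \<Rightarrow> ('d::finite) tensor \<Rightarrow> real \<times> (real ^ 'd) \<Rightarrow> bool" where
  "eigenpair m A = (\<lambda>(l, v). tensor_contract m A v = l *\<^sub>R v \<and> v \<bullet> v = 1)"

definition local_maximizer_on :: "'a::metric_space set \<Rightarrow> ('a \<Rightarrow> real) \<Rightarrow> 'a \<Rightarrow> bool" where
  "local_maximizer_on S f x \<longleftrightarrow> x \<in> S \<and> (\<exists>e>0. \<forall>y\<in>S. dist y x < e \<longrightarrow> f y \<le> f x)"

definition sign_equivalence :: "nat \<Rightarrow> ((real \<times> (real ^ ('d::finite))) \<times> (real \<times> (real ^ 'd))) set" where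
  "sign_equivalence m =
    {((l, v), (l', v')) | l v l' v'.
       (l', v') = (l, v) \<or> (l', v') = ((- 1) ^ (m - 2) * l, - v)}"

text \<open>
  Only representatives with nonnegative eigenvalue qualify, so for odd m this set is not closed
  under \<open>sign_equivalence m\<close>; its quotient consists of the full classes of its members.
\<close>

definition locally_maximized_eigenpairs :: "nat \<Rightarrow> ('d::finite) tensor \<Rightarrow> (real \<times> (real ^ 'd)) set" where
  "locally_maximized_eigenpairs m A =
    {(l, v). eigenpair m A (l, v) \<and> 0 \<le> l \<and> local_maximizer_on (sphere 0 1) (tensor_form m A) v}"

lemma equiv_sign_equivalence: "equiv UNIV (sign_equivalence m)"
  by (cases "even (m - 2)")
    (auto simp: sign_equivalence_def equiv_def refl_on_def sym_def trans_def)

lemma simplex_tensor_sym: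
  fixes W :: "real ^ ('n::finite) ^ ('d::finite)"
  shows "simplex_tensor m W \<in> sym_tensors m"
proof -
  have "outer_power m w js = outer_power m w ks" if "mset js = mset ks" for w :: "real ^ 'd" and js ks
  proof -
    have "prod_list (map (($) w) js) = prod_list (map (($) w) ks)"
      by (metis that mset_map prod_mset_prod_list)
    with mset_eq_length[OF that] show ?thesis
      by (simp add: outer_power_def)
  qed
  then have "simplex_tensor m W js = simplex_tensor m W ks" if "mset js = mset ks" for js ks
    unfolding simplex_tensor_def using that by (intro sum.cong refl) blast
  moreover have "simplex_tensor m W js = 0" if "length js \<noteq> m" for js
    using that by (simp add: simplex_tensor_def outer_power_def)
  ultimately show ?thesis
    unfolding sym_tensors_def by blast
qed

lemma sum_lists_prod:
  "(\<Sum>js | length js = m. \<Prod>j\<leftarrow>js. f j) = (\<Sum>j\<in>UNIV. f j :: real) ^ m" for f :: "'d::finite \<Rightarrow> real"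
proof (induction m)
  case (Suc m)
  have eq: "{js :: 'd list. length js = Suc m} = (\<lambda>(j, js). j # js) ` (UNIV \<times> {js. length js = m})"
    by (auto simp: length_Suc_conv image_iff)
  have "(\<Sum>js | length js = Suc m. \<Prod>j\<leftarrow>js. f j)
      = (\<Sum>(j, js)\<in>UNIV \<times> {js. length js = m}. f j * (\<Prod>j\<leftarrow>js. f j))"
    unfolding eq by (subst sum.reindex) (auto simp: inj_on_def case_prod_beta intro!: sum.cong)
  also have "\<dots> = (\<Sum>j\<in>UNIV. f j) * (\<Sum>js | length js = m. \<Prod>j\<leftarrow>js. f j)"
    by (simp add: sum_product sum.cartesian_product)
  finally show ?case using Suc by simp
qed simp

lemma prod_list_map_mult:
  "(\<Prod>j\<leftarrow>js. f j) * (\<Prod>j\<leftarrow>js. g j) = (\<Prod>j\<leftarrow>js. f j * g j :: real)"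
  by (induction js) (auto simp: algebra_simps)

lemma tensor_form_simplex_tensor:
  "tensor_form m (simplex_tensor m W) v = (\<Sum>i\<in>UNIV. (column i W \<bullet> v) ^ m)"
proof -
  have "tensor_form m (simplex_tensor m W) v
      = (\<Sum>js | length js = m. \<Sum>i\<in>UNIV. \<Prod>j\<leftarrow>js. column i W $ j * v $ j)"
    unfolding tensor_form_def simplex_tensor_def outer_power_def
    by (intro sum.cong) (auto simp: sum_distrib_right prod_list_map_mult)
  also have "\<dots> = (\<Sum>i\<in>UNIV. (column i W \<bullet> v) ^ m)"
    by (subst sum.swap) (simp add: sum_lists_prod inner_vec_def)
  finally show ?thesis .
qed

lemma tensor_contract_simplex_tensor:
  assumes "1 \<le> m"
  shows "tensor_contract m (simplex_tensor m W) v
    = (\<Sum>i\<in>UNIV. (column i W \<bullet> v) ^ (m - 1) *\<^sub>R column i W)"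
proof -
  have "(\<Sum>js | length js = m - 1. simplex_tensor m W (k # js) * (\<Prod>j\<leftarrow>js. v $ j))
      = (\<Sum>i\<in>UNIV. (column i W \<bullet> v) ^ (m - 1) * column i W $ k)" for k
  proof -
    have "(\<Sum>js | length js = m - 1. simplex_tensor m W (k # js) * (\<Prod>j\<leftarrow>js. v $ j))
        = (\<Sum>js | length js = m - 1. \<Sum>i\<in>UNIV. column i W $ k * (\<Prod>j\<leftarrow>js. column i W $ j * v $ j))"
      unfolding simplex_tensor_def outer_power_def using assms
      by (intro sum.cong) (auto simp: sum_distrib_right mult.assoc prod_list_map_mult)
    also have "\<dots> = (\<Sum>i\<in>UNIV. (column i W \<bullet> v) ^ (m - 1) * column i W $ k)"
      by (subst sum.swap)
        (simp add: sum_lists_prod inner_vec_def mult.commute flip: sum_distrib_left)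
    finally show ?thesis .
  qed
  then show ?thesis
    by (simp add: tensor_contract_def vec_eq_iff)
qed

end

theory Submission
  imports Defs "HOL-Computational_Algebra.Polynomial"
begin

text \<open>
  In the coordinates \<open>x\<^sub>i = w\<^sub>i \<bullet> v\<close>, a local maximizer satisfies \<open>x\<^sub>i ^ (m - 1) = a x\<^sub>i + b\<close>,
  that is \<open>g x\<^sub>i = 0\<close> for \<open>g t = t ^ (m - 1) - a t - b\<close>, and the second order condition reads
  \<open>\<Sum>\<^sub>i g' (x\<^sub>i) y\<^sub>i\<^sup>2 \<le> 0\<close> whenever \<open>\<Sum>\<^sub>i y\<^sub>i = 0\<close> and \<open>\<Sum>\<^sub>i x\<^sub>i y\<^sub>i = 0\<close>. Testing with the difference of
  two basis vectors shows that a value with \<open>g' > 0\<close> is attained only once. For odd \<open>m\<close> the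
  function \<open>g\<close> is convex, so there are two values and the larger is attained once. For even \<open>m\<close> there
  are at most three; if three values \<open>\<alpha> < \<beta> < \<gamma>\<close> occur, then only \<open>\<beta>\<close> is repeated, and a suitable test
  vector contradicts \<open>g'(\<alpha>) (\<gamma> - \<beta>)\<^sup>2 + g'(\<gamma>) (\<beta> - \<alpha>)\<^sup>2 + g'(\<beta>) (\<gamma> - \<alpha>)\<^sup>2 \<ge> 0\<close>, where the
  inequality is strict for \<open>m > 4\<close>. Up to a positive factor the left hand side is the divided difference
  of \<open>t ^ (m - 1)\<close> at the double nodes \<open>\<alpha>, \<beta>, \<gamma>\<close>, so its sign is that of a fifth derivative.
  Conversely, a global maximizer exists by compactness, it is some \<open>\<plusminus>w\<^sub>i\<close> by the above, and all \<open>w\<^sub>i\<close>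
  give the same value.
\<close>

section \<open>Calculus in one variable: local maxima, monotonicity of powers, Rolle points\<close>

text \<open>If \<open>D > 0\<close>, then \<open>f'\<close> is positive just to the right of its
  zero at 0, and the mean value theorem makes \<open>f\<close> exceed \<open>f 0\<close>
  there.\<close>

lemma local_max_derivative_conditions:
  fixes f f' :: "real \<Rightarrow> real"
  assumes f': "\<And>t. (f has_real_derivative f' t) (at t)"
    and D: "(f' has_real_derivative D) (at 0)"
    and max: "\<forall>\<^sub>F t in nhds 0. f t \<le> f 0"
  shows "f' 0 = 0" and "D \<le> 0"
proof -
  obtain e where e: "e > 0" "\<And>t. \<bar>t\<bar> < e \<Longrightarrow> f t \<le> f 0"
    using max unfolding eventually_nhds_metric by (auto simp: dist_real_def)
  show crit: "f' 0 = 0"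
    using DERIV_local_max[OF f' e(1)] e(2) by simp
  show "D \<le> 0"
  proof (rule ccontr)
    assume "\<not> D \<le> 0"
    then obtain d where d: "d > 0" "\<And>h. 0 < h \<Longrightarrow> h < d \<Longrightarrow> 0 < f' h"
      using DERIV_pos_inc_right[OF D] crit by auto
    define s where "s = min e d / 2"
    have s: "0 < s" "s < e" "s < d"
      using e(1) d(1) by (auto simp: s_def min_def)
    obtain z where z: "0 < z" "z < s" "f s - f 0 = (s - 0) * f' z"
      using MVT2[of 0 s f f'] s(1) f' by auto
    have "f s > f 0"
      using z s d(2)[of z] by (smt (verit) mult_pos_pos)
    with e(2)[of s] s show False by auto
  qed
qed

lemma even_power_less_iff:
  fixes x y :: real
  assumes "even k" "0 < k"
  shows "x ^ k < y ^ k \<longleftrightarrow> \<bar>x\<bar> < \<bar>y\<bar>"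
  using power_less_imp_less_base[of "\<bar>x\<bar>" k "\<bar>y\<bar>"] power_strict_mono[of "\<bar>x\<bar>" "\<bar>y\<bar>" k] assms
  by (auto simp: power_even_abs)

lemma odd_power_less_iff:
  fixes x y :: real
  assumes "odd k"
  shows "x ^ k < y ^ k \<longleftrightarrow> x < y"
  using power_mono_odd[OF assms, of y x] power_mono_odd[OF assms, of x y]
    odd_real_root_power_cancel[OF assms, of x] odd_real_root_power_cancel[OF assms, of y]
  by (metis less_le not_le)

text \<open>Rolle's theorem for \<open>t ^ (k + 1) - a * t\<close>, which takes the value
  \<open>b\<close> at both ends. Here \<open>k\<close> plays the role of
  \<open>m - 2\<close>.\<close>

lemma rolle_power_affine:
  fixes a b :: real
  assumes "x < y" "x ^ (k + 1) = a * x + b" "y ^ (k + 1) = a * y + b"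
  obtains z where "x < z" "z < y" "real (k + 1) * z ^ k = a"
proof -
  have "\<exists>z>x. z < y \<and> y ^ (k + 1) - a * y - (x ^ (k + 1) - a * x) = (y - x) * (real (k + 1) * z ^ k - a)"
    using assms(1) by (intro MVT2) (auto intro!: derivative_eq_intros simp del: power_Suc)
  with assms that show thesis by auto
qed

lemma poly_rolle:
  fixes p :: "real poly"
  assumes "x < y" "poly p x = 0" "poly p y = 0"
  obtains z where "x < z" "z < y" "poly (pderiv p) z = 0"
  using poly_MVT[of x y p] assms by auto

section \<open>Three roots of an odd power minus an affine function\<close>

text \<open>The difference \<open>G\<close> has double zeros at the three nodes, so Rolle's theorem
  yields five zeros of its first derivative, then four, three and two for the next ones. Comparing
  the fourth derivative at its two zeros gives strictness, because \<open>t ^ (k - 4)\<close> is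
  strictly increasing; a fifth derivative could vanish at the point found. Here \<open>k\<close>
  plays the role of \<open>m - 1\<close>.\<close>

lemma hermite_leading_coeff:
  fixes \<alpha> \<beta> \<gamma> c0 c1 c2 c3 c4 K :: real
  defines "R \<equiv> [:c0, c1, c2, c3, c4, K:]"
  assumes ord: "\<alpha> < \<beta>" "\<beta> < \<gamma>" and "odd k" "3 \<le> k"
    and interp: "\<And>t. t \<in> {\<alpha>, \<beta>, \<gamma>} \<Longrightarrow> t ^ k = poly R t"
      "\<And>t. t \<in> {\<alpha>, \<beta>, \<gamma>} \<Longrightarrow> real k * t ^ (k - 1) = poly (pderiv R) t"
  shows "0 \<le> K" and "3 < k \<Longrightarrow> 0 < K"
proof -
  define G where "G = monom 1 k - R"
  have G: "poly G t = 0" "poly (pderiv G) t = 0" if "t \<in> {\<alpha>, \<beta>, \<gamma>}" for t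
    using interp[OF that] by (auto simp: G_def poly_monom pderiv_diff pderiv_monom)
  obtain p1 where p1: "\<alpha> < p1" "p1 < \<beta>" "poly (pderiv G) p1 = 0"
    using poly_rolle[OF ord(1) G(1) G(1)] by auto
  obtain p2 where p2: "\<beta> < p2" "p2 < \<gamma>" "poly (pderiv G) p2 = 0"
    using poly_rolle[OF ord(2) G(1) G(1)] by auto
  obtain q1 where q1: "\<alpha> < q1" "q1 < p1" "poly (pderiv (pderiv G)) q1 = 0"
    using poly_rolle[OF p1(1) G(2) p1(3)] by auto
  obtain q2 where q2: "p1 < q2" "q2 < \<beta>" "poly (pderiv (pderiv G)) q2 = 0"
    using poly_rolle[OF p1(2,3) G(2)] by auto
  obtain q3 where q3: "\<beta> < q3" "q3 < p2" "poly (pderiv (pderiv G)) q3 = 0"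
    using poly_rolle[OF p2(1) G(2) p2(3)] by auto
  obtain q4 where q4: "p2 < q4" "q4 < \<gamma>" "poly (pderiv (pderiv G)) q4 = 0"
    using poly_rolle[OF p2(2,3) G(2)] by auto
  have q: "q1 < q2" "q2 < q3" "q3 < q4"
    using q1 q2 q3 q4 by auto
  obtain r1 where r1: "q1 < r1" "r1 < q2" "poly (pderiv (pderiv (pderiv G))) r1 = 0"
    using poly_rolle[OF q(1) q1(3) q2(3)] by auto
  obtain r2 where r2: "q2 < r2" "r2 < q3" "poly (pderiv (pderiv (pderiv G))) r2 = 0"
    using poly_rolle[OF q(2) q2(3) q3(3)] by auto
  obtain r3 where r3: "q3 < r3" "r3 < q4" "poly (pderiv (pderiv (pderiv G))) r3 = 0"
    using poly_rolle[OF q(3) q3(3) q4(3)] by auto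
  have r: "r1 < r2" "r2 < r3"
    using r1 r2 r3 by auto
  obtain s1 where s1: "r1 < s1" "s1 < r2" "poly (pderiv (pderiv (pderiv (pderiv G)))) s1 = 0"
    using poly_rolle[OF r(1) r1(3) r2(3)] by auto
  obtain s2 where s2: "r2 < s2" "s2 < r3" "poly (pderiv (pderiv (pderiv (pderiv G)))) s2 = 0"
    using poly_rolle[OF r(2) r2(3) r3(3)] by auto
  \<comment> \<open>The falling factorial from four differentiations. For \<open>k = 3\<close> it is
    0, so the truncated exponent \<open>k - 4\<close> does no harm.\<close>
  define c where "c = real k * real (k - 1) * real (k - 2) * real (k - 3)"
  have G4: "poly (pderiv (pderiv (pderiv (pderiv G)))) t = c * t ^ (k - 4) - 120 * K * t - 24 * c4" for t
    by (simp add: G_def R_def c_def pderiv_diff pderiv_monom poly_monom pderiv_pCons algebra_simps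
        numeral_eq_Suc)
  have s: "s1 < s2"
    using s1 s2 by auto
  have eq: "c * (s2 ^ (k - 4) - s1 ^ (k - 4)) = 120 * K * (s2 - s1)"
    using s1(3) s2(3) by (simp add: G4 algebra_simps)
  have "0 < c \<and> s1 ^ (k - 4) < s2 ^ (k - 4)" if "3 < k"
    using that s \<open>odd k\<close> by (auto simp: c_def odd_power_less_iff)
  then have pos: "0 < 120 * K * (s2 - s1)" if "3 < k"
    using that unfolding eq[symmetric] by simp
  then show "3 < k \<Longrightarrow> 0 < K"
    using s by (simp add: zero_less_mult_iff)
  moreover have "0 = K" if "k = 3"
    using eq s that by (simp add: c_def)
  ultimately show "0 \<le> K"
    using \<open>3 \<le> k\<close> by fastforce
qed

text \<open>
  Hermite interpolation of \<open>t ^ k\<close> at the double nodes: \<open>R\<close> is the affine function plus \<open>P * Q\<close>, where the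
  quadratic \<open>Q\<close> is chosen by Lagrange interpolation to match the derivatives.
\<close>

lemma three_root_second_order:
  fixes \<alpha> \<beta> \<gamma> a b :: real and k :: nat
  defines "g' \<equiv> \<lambda>t. real k * t ^ (k - 1) - a"
  assumes ord: "\<alpha> < \<beta>" "\<beta> < \<gamma>" and "odd k" "3 \<le> k"
    and root: "\<And>t. t \<in> {\<alpha>, \<beta>, \<gamma>} \<Longrightarrow> t ^ k = a * t + b"
  defines "E \<equiv> g' \<alpha> * (\<gamma> - \<beta>)\<^sup>2 + g' \<gamma> * (\<beta> - \<alpha>)\<^sup>2 + g' \<beta> * (\<gamma> - \<alpha>)\<^sup>2"
  shows "0 \<le> E" and "3 < k \<Longrightarrow> 0 < E"
proof -
  define A B C where "A = \<gamma> - \<beta>" and "B = \<beta> - \<alpha>" and "C = \<gamma> - \<alpha>"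
  have ABC: "0 < A" "0 < B" "0 < C"
    using ord by (auto simp: A_def B_def C_def)
  define P where "P = [:-\<alpha>, 1:] * [:-\<beta>, 1:] * [:-\<gamma>, 1:]"
  \<comment> \<open>At a node \<open>P\<close> vanishes, so matching derivatives means that
    \<open>pderiv P\<close> times \<open>Q\<close> equals \<open>g'\<close>. Both factors contain
    the same product of node differences up to the weight, whence the squares.\<close>
  define l1 l2 l3 where "l1 = g' \<alpha> / (B * C)\<^sup>2" and "l2 = g' \<beta> / (A * B)\<^sup>2" and "l3 = g' \<gamma> / (A * C)\<^sup>2"
  define Q where "Q = smult l1 ([:-\<beta>, 1:] * [:-\<gamma>, 1:]) + smult l2 ([:-\<alpha>, 1:] * [:-\<gamma>, 1:])
    + smult l3 ([:-\<alpha>, 1:] * [:-\<beta>, 1:])"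
  define R where "R = P * Q + [:b, a:]"
  \<comment> \<open>The leading coefficient of \<open>R\<close>: \<open>P\<close> is a monic cubic
    and \<open>Q\<close> has this quadratic coefficient.\<close>
  define K where "K = l1 + l2 + l3"
  have "R = [:coeff R 0, coeff R 1, coeff R 2, coeff R 3, coeff R 4, K:]"
    unfolding R_def P_def Q_def K_def by (simp add: numeral_eq_Suc)
  then obtain c0 c1 c2 c3 c4 where R: "R = [:c0, c1, c2, c3, c4, K:]"
    by blast
  have P0: "poly P t = 0" if "t \<in> {\<alpha>, \<beta>, \<gamma>}" for t
    using that unfolding P_def poly_mult by auto
  have i1: "t ^ k = poly R t" if "t \<in> {\<alpha>, \<beta>, \<gamma>}" for t
    using root[OF that] P0[OF that] by (simp add: R_def)
  have "poly (pderiv P) \<alpha> = B * C" "poly Q \<alpha> = l1 * (B * C)"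
    "poly (pderiv P) \<beta> = - (A * B)" "poly Q \<beta> = l2 * - (A * B)"
    "poly (pderiv P) \<gamma> = A * C" "poly Q \<gamma> = l3 * (A * C)"
    unfolding P_def Q_def pderiv_mult poly_mult poly_add poly_smult
    by (simp_all add: pderiv_pCons A_def B_def C_def algebra_simps)
  then have "poly (pderiv P) t * poly Q t = g' t" if "t \<in> {\<alpha>, \<beta>, \<gamma>}" for t
    using that ABC by (auto simp: l1_def l2_def l3_def power2_eq_square)
  then have i2: "real k * t ^ (k - 1) = poly (pderiv R) t" if "t \<in> {\<alpha>, \<beta>, \<gamma>}" for t
    using that P0[OF that] by (simp add: R_def pderiv_add pderiv_mult pderiv_pCons g'_def mult.commute)
  have "l1 * (A * B * C)\<^sup>2 = g' \<alpha> * A\<^sup>2" "l2 * (A * B * C)\<^sup>2 = g' \<beta> * C\<^sup>2"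
    "l3 * (A * B * C)\<^sup>2 = g' \<gamma> * B\<^sup>2"
    using ABC by (simp_all add: l1_def l2_def l3_def power_mult_distrib)
  then have E: "E = K * (A * B * C)\<^sup>2"
    by (simp add: E_def K_def distrib_right flip: A_def B_def C_def)
  show "0 \<le> E"
    using hermite_leading_coeff(1)[OF ord \<open>odd k\<close> \<open>3 \<le> k\<close> i1[unfolded R] i2[unfolded R]]
    by (auto simp: E)
  show "0 < E" if "3 < k"
    using hermite_leading_coeff(2)[OF ord \<open>odd k\<close> \<open>3 \<le> k\<close> i1[unfolded R] i2[unfolded R]] that ABC
    by (auto simp: E)
qed

text \<open>For even \<open>k\<close> the derivative depends on \<open>\<bar>t\<bar>\<close> only
  and increases with it. Hence the two Rolle points are opposite, with \<open>\<beta>\<close>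
  between them and \<open>\<alpha>\<close>, \<open>\<gamma>\<close> outside; a fourth root would
  produce a third Rolle point of the same absolute value.\<close>

lemma three_roots_derivative_signs:
  fixes a b :: real
  assumes "even k" "0 < k" and ord: "\<alpha> < \<beta>" "\<beta> < \<gamma>"
    and root: "\<And>t. t \<in> {\<alpha>, \<beta>, \<gamma>} \<Longrightarrow> t ^ (k + 1) = a * t + b"
  shows "a < real (k + 1) * \<alpha> ^ k" "real (k + 1) * \<beta> ^ k < a" "a < real (k + 1) * \<gamma> ^ k"
    and "\<gamma> < \<delta> \<Longrightarrow> \<delta> ^ (k + 1) \<noteq> a * \<delta> + b"
proof -
  have cmp: "real (k + 1) * x ^ k < real (k + 1) * y ^ k \<longleftrightarrow> \<bar>x\<bar> < \<bar>y\<bar>" for x y :: real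
    using even_power_less_iff[OF assms(1,2)] by (simp add: mult_less_cancel_left_pos)
  obtain z1 where z1: "\<alpha> < z1" "z1 < \<beta>" "real (k + 1) * z1 ^ k = a"
    using rolle_power_affine[OF ord(1) root root] by auto
  obtain z2 where z2: "\<beta> < z2" "z2 < \<gamma>" "real (k + 1) * z2 ^ k = a"
    using rolle_power_affine[OF ord(2) root root] by auto
  have z: "\<bar>z1\<bar> = \<bar>z2\<bar>"
    using cmp[of z1 z2] cmp[of z2 z1] z1(3) z2(3) by linarith
  show "a < real (k + 1) * \<alpha> ^ k" "real (k + 1) * \<beta> ^ k < a" "a < real (k + 1) * \<gamma> ^ k"
    using cmp[of z1 \<alpha>] cmp[of \<beta> z1] cmp[of z1 \<gamma>] z z1 z2 by linarith+
  show "\<delta> ^ (k + 1) \<noteq> a * \<delta> + b" if "\<gamma> < \<delta>"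
  proof
    assume "\<delta> ^ (k + 1) = a * \<delta> + b"
    then obtain z3 where z3: "\<gamma> < z3" "z3 < \<delta>" "real (k + 1) * z3 ^ k = a"
      using rolle_power_affine[OF \<open>\<gamma> < \<delta>\<close> root] by auto
    then show False
      using cmp[of z2 z3] z z1 z2 by linarith
  qed
qed


section \<open>Coordinate vectors that satisfy the second order conditions\<close>

lemma sum_two_exceptions:
  fixes f :: "'n::finite \<Rightarrow> real"
  assumes "i \<noteq> l" "\<And>p. p \<noteq> i \<Longrightarrow> p \<noteq> l \<Longrightarrow> f p = c"
  shows "sum f UNIV = f i + f l + (real CARD('n) - 2) * c"
proof -
  have "2 \<le> CARD('n)"
    using card_mono[of UNIV "{i, l}"] assms(1) by simp
  moreover have "sum f UNIV = sum f {i, l} + sum f (UNIV - {i, l})"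
    using sum.subset_diff[of "{i, l}" UNIV f] by (simp add: add.commute)
  moreover have "sum f (UNIV - {i, l}) = real (card (UNIV - {i, l})) * c"
    using assms(2) by simp
  moreover have "card (UNIV - {i, l}) = CARD('n) - 2"
    using assms(1) by (simp add: card_Diff_subset)
  ultimately show ?thesis
    using assms(1) by (simp add: of_nat_diff)
qed

text \<open>The zero sum determines \<open>q\<close> from \<open>x i\<close>, and the sum of squares
  then forces \<open>(x i)^2 = 1\<close>: these are the coordinates of a frame vector or its
  negative.\<close>

lemma one_exceptional_value:
  fixes x :: "'n::finite \<Rightarrow> real"
  assumes "2 \<le> CARD('n)" "sum x UNIV = 0"
    and sq: "(\<Sum>i\<in>UNIV. (x i)\<^sup>2) = real CARD('n) / (real CARD('n) - 1)"
    and q: "\<And>j. j \<noteq> i \<Longrightarrow> x j = q"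
  shows "x i = 1 \<or> x i = -1" and "x i = - (real CARD('n) - 1) * q"
proof -
  let ?N = "real CARD('n)"
  have N: "?N \<ge> 2"
    using assms(1) by simp
  have eq: "sum f UNIV = f i + (?N - 1) * c" if "\<And>j. j \<noteq> i \<Longrightarrow> f j = c" for f :: "'n \<Rightarrow> real" and c
    using that N by (simp add: sum.remove[of UNIV i f] of_nat_diff)
  show lin: "x i = - (?N - 1) * q"
    using eq[of x q] q assms(2) by (simp add: algebra_simps)
  have "(x i)\<^sup>2 + (?N - 1) * q\<^sup>2 = ?N / (?N - 1)"
    using eq[of "\<lambda>j. (x j)\<^sup>2" "q\<^sup>2"] q sq by simp
  then have "(?N - 1) * (x i)\<^sup>2 + ((?N - 1) * q)\<^sup>2 = ?N"
    using N by (simp add: field_simps power2_eq_square)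
  moreover have "((?N - 1) * q)\<^sup>2 = (x i)\<^sup>2"
    by (simp add: lin power2_eq_square algebra_simps)
  ultimately have "?N * ((x i)\<^sup>2 - 1) = 0"
    by (simp add: algebra_simps)
  then have "(x i)\<^sup>2 = 1"
    using N by simp
  then show "x i = 1 \<or> x i = -1"
    by (simp add: power2_eq_1_iff)
qed

text \<open>The part of the argument free of geometry: the hypotheses collect what a local maximizer
  \<open>v\<close> gives for \<open>x i = w i \<bullet> v\<close>, and a coordinate 1 or -1 will
  identify \<open>v\<close> by equality in Cauchy-Schwarz.\<close>

lemma second_order_critical_values:
  fixes x :: "'n::finite \<Rightarrow> real" and a b :: real
  assumes N: "3 \<le> CARD('n)" and k: "1 \<le> k" "\<not> (k = 2 \<and> CARD('n) = 3)"
    and sum0: "sum x UNIV = 0"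
    and sq: "(\<Sum>i\<in>UNIV. (x i)\<^sup>2) = real CARD('n) / (real CARD('n) - 1)"
    and root: "\<And>i. x i ^ (k + 1) = a * x i + b"
    and hess: "\<And>y. sum y UNIV = 0 \<Longrightarrow> (\<Sum>i\<in>UNIV. x i * y i) = 0 \<Longrightarrow>
      (\<Sum>i\<in>UNIV. (real (k + 1) * x i ^ k - a) * (y i)\<^sup>2) \<le> 0"
  shows "\<exists>i. x i = 1 \<or> (even k \<and> x i = -1)"
proof -
  let ?N = "real CARD('n)"
  define g' where "g' t = real (k + 1) * t ^ k - a" for t
  define \<alpha> \<gamma> where "\<alpha> = Min (range x)" and "\<gamma> = Max (range x)"
  have range: "\<alpha> \<le> x i" "x i \<le> \<gamma>" for i
    by (auto simp: \<alpha>_def \<gamma>_def)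
  have "\<alpha> \<in> range x" "\<gamma> \<in> range x"
    unfolding \<alpha>_def \<gamma>_def by (intro Min_in Max_in; simp)+
  then obtain i l where i: "x i = \<alpha>" and l: "x l = \<gamma>"
    by auto
  have "\<alpha> \<noteq> \<gamma>"
  proof
    assume "\<alpha> = \<gamma>"
    then have "x j = \<alpha>" for j
      using range[of j] by simp
    then have x: "x = (\<lambda>_. \<alpha>)"
      by auto
    then have "\<alpha> = 0"
      using sum0 by simp
    then show False
      using sq x N by simp
  qed
  then have "\<alpha> < \<gamma>"
    using range[of i] i by auto
  have il: "i \<noteq> l"
    using \<open>\<alpha> \<noteq> \<gamma>\<close> i l by auto
  have repeated: "g' (x p) \<le> 0" if "p \<noteq> q" "x p = x q" for p q
  proof -
    define y :: "'n \<Rightarrow> real" where "y j = (if j = p then 1 else if j = q then -1 else 0)" for j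
    have "sum y UNIV = 0"
      using sum_two_exceptions[OF that(1), of y 0] that(1) by (simp add: y_def)
    moreover have "(\<Sum>j\<in>UNIV. x j * y j) = 0"
      using sum_two_exceptions[OF that(1), of "\<lambda>j. x j * y j" 0] that by (simp add: y_def)
    moreover have "(\<Sum>j\<in>UNIV. (real (k + 1) * x j ^ k - a) * (y j)\<^sup>2) = 2 * g' (x p)"
      using sum_two_exceptions[OF that(1), of "\<lambda>j. (real (k + 1) * x j ^ k - a) * (y j)\<^sup>2" 0] that
      by (simp add: y_def g'_def)
    ultimately show ?thesis
      using hess[of y] by simp
  qed
  show ?thesis
  proof (cases "odd k")
    case True
    have cmp: "g' s < g' t" if "s < t" for s t
      using that odd_power_less_iff[OF True, of s t] by (simp add: g'_def)
    \<comment> \<open>A third value would give two zeros of the strictly increasing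
      \<open>g'\<close>; and \<open>\<gamma>\<close> lies to the right of such a zero, so it is not
      repeated.\<close>
    have "x j = \<alpha>" if "j \<noteq> l" for j
    proof (rule ccontr)
      assume "x j \<noteq> \<alpha>"
      then have j: "\<alpha> < x j"
        using range[of j] by simp
      obtain z where z: "\<alpha> < z" "z < x j" "g' z = 0"
        using rolle_power_affine[OF j, of k a b] root[of i] root[of j] i by (auto simp: g'_def)
      show False
      proof (cases "x j = \<gamma>")
        case True
        then show False
          using repeated[OF that] l cmp[OF z(2)] z(3) by simp
      next
        case False
        then have "x j < \<gamma>"
          using range[of j] by simp
        then obtain z' where "x j < z'" "g' z' = 0"
          using rolle_power_affine[of "x j" \<gamma> k a b] root[of j] root[of l] l by (auto simp: g'_def)
        then show False
          using cmp[of z z'] z by simp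
      qed
    qed
    then have one: "x l = 1 \<or> x l = -1" "\<gamma> = (?N - 1) * - \<alpha>"
      using one_exceptional_value[OF _ sum0 sq, of l \<alpha>] N l by (simp_all add: algebra_simps)
    \<comment> \<open>This rules out -1: if \<open>\<gamma>\<close> were not positive,
      \<open>\<alpha>\<close> would be negative and the zero sum would make \<open>\<gamma>\<close>
      positive.\<close>
    have "0 < \<gamma>"
    proof (rule ccontr)
      assume "\<not> 0 < \<gamma>"
      then have "0 < (?N - 1) * - \<alpha>"
        using N \<open>\<alpha> < \<gamma>\<close> by (intro mult_pos_pos) auto
      with one(2) \<open>\<not> 0 < \<gamma>\<close> show False by simp
    qed
    then show ?thesis
      using one(1) l by auto
  next
    case False
    have k2: "even k" "0 < k" "2 \<le> k"
      using False k(1) by (auto elim: evenE)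
    show ?thesis
    proof (cases "\<exists>j. \<alpha> < x j \<and> x j < \<gamma>")
      case False
      have two: "x j = \<alpha> \<or> x j = \<gamma>" for j
        using False range[of j] by (metis less_le)
      have "(\<forall>j. j \<noteq> i \<longrightarrow> x j = \<gamma>) \<or> (\<forall>j. j \<noteq> l \<longrightarrow> x j = \<alpha>)"
      proof (rule ccontr)
        assume "\<not> ?thesis"
        then obtain p q where "p \<noteq> i" "x p = x i" "q \<noteq> l" "x q = x l"
          using two i l by metis
        then have g'0: "g' \<alpha> \<le> 0" "g' \<gamma> \<le> 0"
          using repeated[of p i] repeated[of q l] i l by auto
        obtain z where z: "\<alpha> < z" "z < \<gamma>" "g' z = 0"
          using rolle_power_affine[OF \<open>\<alpha> < \<gamma>\<close>, of k a b] root[of i] root[of l] i l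
          by (auto simp: g'_def)
        \<comment> \<open>\<open>g'\<close> is even and increasing in \<open>\<bar>t\<bar>\<close>, so \<open>g' \<le> 0\<close> confines both values to \<open>[-\<bar>z\<bar>, \<bar>z\<bar>]\<close>.\<close>
        have "\<bar>t\<bar> \<le> \<bar>z\<bar>" if "g' t \<le> 0" for t
        proof (rule ccontr)
          assume "\<not> \<bar>t\<bar> \<le> \<bar>z\<bar>"
          then have "z ^ k < t ^ k"
            using even_power_less_iff[OF k2(1,2)] by simp
          then have "g' z < g' t"
            by (simp add: g'_def)
          with that z(3) show False by simp
        qed
        from this[OF g'0(1)] this[OF g'0(2)] show False
          using z(1,2) by linarith
      qed
      then show ?thesis
        using one_exceptional_value(1)[OF _ sum0 sq, of i \<gamma>]
          one_exceptional_value(1)[OF _ sum0 sq, of l \<alpha>] N k2(1) by auto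
    next
      case True
      then obtain j where j: "\<alpha> < x j" "x j < \<gamma>"
        by auto
      define \<beta> where "\<beta> = x j"
      note ord = j[folded \<beta>_def]
      have roots: "t ^ (k + 1) = a * t + b" if "t \<in> {\<alpha>, \<beta>, \<gamma>}" for t
        using that root[of i] root[of l] root[of j] i l by (auto simp: \<beta>_def)
      note signs = three_roots_derivative_signs[OF k2(1,2) ord roots]
      \<comment> \<open>The extreme values have \<open>g' > 0\<close> and are not repeated. Any
        other new value is a fourth root, excluded by taking \<open>\<gamma>\<close> as the largest
        of the four.\<close>
      have others: "x p = \<beta>" if "p \<noteq> i" "p \<noteq> l" for p
      proof (rule ccontr)
        assume "x p \<noteq> \<beta>"
        have "x p \<noteq> \<alpha>"
          using repeated[OF that(1)] i signs(1) by (auto simp: g'_def)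
        moreover have "x p \<noteq> \<gamma>"
          using repeated[OF that(2)] l signs(3) by (auto simp: g'_def)
        ultimately consider "\<alpha> < x p" "x p < \<beta>" | "\<beta> < x p" "x p < \<gamma>"
          using range[of p] \<open>x p \<noteq> \<beta>\<close> by fastforce
        then show False
        proof cases
          case 1
          have "t ^ (k + 1) = a * t + b" if "t \<in> {\<alpha>, x p, \<beta>}" for t
            using that roots root[of p] by auto
          from three_roots_derivative_signs(4)[OF k2(1,2) 1 this ord(2)] roots[of \<gamma>]
          show False by simp
        next
          case 2
          have "t ^ (k + 1) = a * t + b" if "t \<in> {\<alpha>, \<beta>, x p}" for t
            using that roots root[of p] by auto
          from three_roots_derivative_signs(4)[OF k2(1,2) ord(1) 2(1) this 2(2)] roots[of \<gamma>]
          show False by simp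
        qed
      qed
      \<comment> \<open>The coefficients of the affine dependence \<open>(\<gamma> - \<beta>) *
        \<alpha> + (\<beta> - \<alpha>) * \<gamma> = (\<gamma> - \<alpha>) * \<beta>\<close>, the
        last one spread evenly over the coordinates equal to \<open>\<beta>\<close>.\<close>
      define y where "y p = (if p = i then \<gamma> - \<beta> else if p = l then \<beta> - \<alpha> else - (\<gamma> - \<alpha>) / (?N - 2))" for p
      note sum2 = sum_two_exceptions[OF il]
      have N2: "?N - 2 > 0"
        using N by simp
      have "sum y UNIV = 0"
        using sum2[of y "- (\<gamma> - \<alpha>) / (?N - 2)"] il N2 by (simp add: y_def)
      moreover have "(\<Sum>p\<in>UNIV. x p * y p)
          = \<alpha> * (\<gamma> - \<beta>) + \<gamma> * (\<beta> - \<alpha>) + (?N - 2) * (\<beta> * (- (\<gamma> - \<alpha>) / (?N - 2)))"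
        using sum2[of "\<lambda>p. x p * y p" "\<beta> * (- (\<gamma> - \<alpha>) / (?N - 2))"] il others i l
        by (simp add: y_def)
      moreover have "(?N - 2) * (\<beta> * (- (\<gamma> - \<alpha>) / (?N - 2))) = \<beta> * (\<alpha> - \<gamma>)"
        using N2 by simp
      then have "\<alpha> * (\<gamma> - \<beta>) + \<gamma> * (\<beta> - \<alpha>) + (?N - 2) * (\<beta> * (- (\<gamma> - \<alpha>) / (?N - 2))) = 0"
        by (simp only:) (simp add: algebra_simps)
      ultimately have "(\<Sum>p\<in>UNIV. g' (x p) * (y p)\<^sup>2) \<le> 0"
        using hess[of y] by (simp add: g'_def)
      moreover have "(\<Sum>p\<in>UNIV. g' (x p) * (y p)\<^sup>2)
          = g' \<alpha> * (\<gamma> - \<beta>)\<^sup>2 + g' \<gamma> * (\<beta> - \<alpha>)\<^sup>2 + (?N - 2) * (g' \<beta> * ((\<gamma> - \<alpha>) / (?N - 2))\<^sup>2)"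
        using sum2[of "\<lambda>p. g' (x p) * (y p)\<^sup>2" "g' \<beta> * ((\<gamma> - \<alpha>) / (?N - 2))\<^sup>2"] il others i l
        by (simp add: y_def power2_commute power_divide)
      moreover have "(?N - 2) * (g' \<beta> * ((\<gamma> - \<alpha>) / (?N - 2))\<^sup>2) = g' \<beta> * (\<gamma> - \<alpha>)\<^sup>2 / (?N - 2)"
        using N2 by (simp add: power2_eq_square)
      ultimately have le: "g' \<alpha> * (\<gamma> - \<beta>)\<^sup>2 + g' \<gamma> * (\<beta> - \<alpha>)\<^sup>2 + g' \<beta> * (\<gamma> - \<alpha>)\<^sup>2 / (?N - 2) \<le> 0"
        by simp
      have neg: "g' \<beta> * (\<gamma> - \<alpha>)\<^sup>2 < 0"
        using signs(2) ord by (simp add: g'_def mult_less_0_iff)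
      have E: "0 \<le> g' \<alpha> * (\<gamma> - \<beta>)\<^sup>2 + g' \<gamma> * (\<beta> - \<alpha>)\<^sup>2 + g' \<beta> * (\<gamma> - \<alpha>)\<^sup>2"
        "3 < k + 1 \<Longrightarrow> 0 < g' \<alpha> * (\<gamma> - \<beta>)\<^sup>2 + g' \<gamma> * (\<beta> - \<alpha>)\<^sup>2 + g' \<beta> * (\<gamma> - \<alpha>)\<^sup>2"
        using three_root_second_order[OF ord _ _ roots] k2 by (auto simp: g'_def)
      show ?thesis
      \<comment> \<open>With three coordinates the contradiction needs the strict inequality, hence
        \<open>k > 2\<close>. With more, strictness comes from dividing the negative term by
        \<open>?N - 2 > 1\<close>.\<close>
      proof (cases "CARD('n) = 3")
        case True
        then show ?thesis
          using E(2) le k(2) k2 by fastforce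
      next
        case False
        then have "1 < ?N - 2"
          using N by simp
        then have "g' \<beta> * (\<gamma> - \<alpha>)\<^sup>2 < g' \<beta> * (\<gamma> - \<alpha>)\<^sup>2 / (?N - 2)"
          using mult_strict_left_mono_neg[OF \<open>1 < ?N - 2\<close> neg] by (simp add: less_divide_eq)
        then show ?thesis
          using E(1) le by simp
      qed
    qed
  qed
qed

section \<open>Power sums over a simplex frame on the unit sphere\<close>

locale simplex_frame =
  fixes w :: "'n::finite \<Rightarrow> 'a::euclidean_space"
  assumes card_ge: "3 \<le> CARD('n)"
    and inner_w: "w i \<bullet> w j = (if i = j then 1 else - 1 / (real CARD('n) - 1))"
    and tight: "(\<Sum>i\<in>UNIV. (w i \<bullet> u) * (w i \<bullet> v)) = real CARD('n) / (real CARD('n) - 1) * (u \<bullet> v)"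
begin

definition power_sum :: "nat \<Rightarrow> 'a \<Rightarrow> real" where
  "power_sum m v = (\<Sum>i\<in>UNIV. (w i \<bullet> v) ^ m)"

lemma N_ge: "3 \<le> real CARD('n)"
  using card_ge by simp

lemma norm_w: "norm (w i) = 1"
  by (simp add: norm_eq_sqrt_inner inner_w)

text \<open>Recovers coordinates: every zero-sum \<open>y\<close> is, up to the factor
  \<open>N / (N - 1)\<close> with \<open>N = CARD('n)\<close>, the coordinate vector of its
  combination. It also turns the eigenvector equation into scalar equations.\<close>

lemma inner_combination:
  "w j \<bullet> (\<Sum>i\<in>UNIV. y i *\<^sub>R w i) = (real CARD('n) * y j - sum y UNIV) / (real CARD('n) - 1)"
proof -
  have "w j \<bullet> (\<Sum>i\<in>UNIV. y i *\<^sub>R w i) = (\<Sum>i\<in>UNIV. y i * (w j \<bullet> w i))"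
    by (simp add: inner_sum_right)
  also have "\<dots> = y j + (\<Sum>i\<in>UNIV - {j}. y i * (- 1 / (real CARD('n) - 1)))"
    by (subst sum.remove[of UNIV j]) (auto simp: inner_w intro!: sum.cong)
  also have "(\<Sum>i\<in>UNIV - {j}. y i * (- 1 / (real CARD('n) - 1))) = - (sum y UNIV - y j) / (real CARD('n) - 1)"
    unfolding sum_distrib_right[symmetric] by (simp add: sum_diff1 diff_divide_distrib)
  also have "y j + - (sum y UNIV - y j) / (real CARD('n) - 1) = (real CARD('n) * y j - sum y UNIV) / (real CARD('n) - 1)"
    using N_ge by (simp add: field_simps)
  finally show ?thesis .
qed

lemma sum_w: "(\<Sum>i\<in>UNIV. w i) = 0"
proof -
  have "w j \<bullet> (\<Sum>i\<in>UNIV. w i) = 0" for j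
    using inner_combination[of j "\<lambda>_. 1"] by simp
  then have "(\<Sum>i\<in>UNIV. w i) \<bullet> (\<Sum>i\<in>UNIV. w i) = 0"
    by (subst inner_sum_left) simp
  then show ?thesis by simp
qed

lemma sum_inner_w: "(\<Sum>i\<in>UNIV. w i \<bullet> v) = 0"
  by (simp add: sum_w flip: inner_sum_left)

lemma sum_inner_w_sq: "(\<Sum>i\<in>UNIV. (w i \<bullet> v)\<^sup>2) = real CARD('n) / (real CARD('n) - 1) * (v \<bullet> v)"
  using tight[of v v] by (simp add: power2_eq_square)

lemma power_sum_w: "power_sum m (w i) = 1 + (real CARD('n) - 1) * (- 1 / (real CARD('n) - 1)) ^ m"
proof -
  have "power_sum m (w i) = 1 + (\<Sum>j\<in>UNIV - {i}. (- 1 / (real CARD('n) - 1)) ^ m)"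
    unfolding power_sum_def by (subst sum.remove[of UNIV i]) (auto simp: inner_w intro!: sum.cong)
  then show ?thesis
    using N_ge by (simp add: of_nat_diff)
qed

text \<open>Makes \<open>w i\<close> an admissible representative: the terms other than the leading
  1 have total absolute value at most 1.\<close>

lemma power_sum_w_nonneg:
  assumes "1 \<le> m"
  shows "0 \<le> power_sum m (w i)"
proof -
  have "(1 / (real CARD('n) - 1)) ^ m \<le> (1 / (real CARD('n) - 1)) ^ 1"
    using N_ge assms by (intro power_decreasing) auto
  then have "(real CARD('n) - 1) * (1 / (real CARD('n) - 1)) ^ m \<le> 1"
    using N_ge by (simp add: field_simps)
  moreover have "\<bar>(real CARD('n) - 1) * (- 1 / (real CARD('n) - 1)) ^ m\<bar> = (real CARD('n) - 1) * (1 / (real CARD('n) - 1)) ^ m"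
    using N_ge by (simp add: abs_mult power_abs)
  ultimately show ?thesis
    unfolding power_sum_w by linarith
qed

text \<open>Differentiation along the great circle
  \<open>cos t *\<^sub>R v + sin t *\<^sub>R z\<close>; its curvature contributes the power sum on
  the right. Homogeneity in \<open>u\<close> reduces the claim to unit vectors
  \<open>z\<close>.\<close>

lemma power_sum_tangent_conditions:
  assumes max: "local_maximizer_on (sphere 0 1) (power_sum (k + 2)) v" and u: "u \<bullet> v = 0"
  shows "(\<Sum>i\<in>UNIV. (w i \<bullet> v) ^ (k + 1) * (w i \<bullet> u)) = 0"
    and "(\<Sum>i\<in>UNIV. real (k + 1) * (w i \<bullet> v) ^ k * (w i \<bullet> u)\<^sup>2) \<le> power_sum (k + 2) v * (u \<bullet> u)"
proof -
  obtain e where v: "norm v = 1" and e: "0 < e"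
    "\<And>y. norm y = 1 \<Longrightarrow> dist y v < e \<Longrightarrow> power_sum (k + 2) y \<le> power_sum (k + 2) v"
    using max unfolding local_maximizer_on_def by auto
  have *: "(\<Sum>i\<in>UNIV. (w i \<bullet> v) ^ (k + 1) * (w i \<bullet> z)) = 0 \<and>
    (\<Sum>i\<in>UNIV. real (k + 1) * (w i \<bullet> v) ^ k * (w i \<bullet> z)\<^sup>2) \<le> power_sum (k + 2) v"
    if z: "z \<bullet> v = 0" "norm z = 1" for z
  proof -
    define c where "c t = cos t *\<^sub>R v + sin t *\<^sub>R z" for t
    define x y where "x i = w i \<bullet> v" and "y i = w i \<bullet> z" for i
    define f where "f t = power_sum (k + 2) (c t)" for t
    define f' where "f' t = (\<Sum>i\<in>UNIV. real (k + 2) * (x i * cos t + y i * sin t) ^ (k + 1)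
      * (y i * cos t - x i * sin t))" for t
    define D where "D = (\<Sum>i\<in>UNIV. real (k + 2) * (real (k + 1) * x i ^ k * (y i)\<^sup>2 - x i ^ (k + 2)))"
    have "norm (c t) ^ 2 = 1" for t
      using z v unfolding power2_norm_eq_inner
      by (simp add: c_def inner_add_left inner_add_right inner_commute[of v z] norm_eq_1
          flip: power2_eq_square)
    then have c1: "norm (c t) = 1" for t
      using power2_eq_iff_nonneg[of "norm (c t)" 1] by simp
    have "isCont c 0"
      unfolding c_def by (intro continuous_intros)
    then have "\<forall>\<^sub>F t in nhds 0. dist (c t) (c 0) < e"
      using e(1) unfolding continuous_at_eps_delta eventually_nhds_metric by auto
    then have "\<forall>\<^sub>F t in nhds 0. f t \<le> f 0"
      by eventually_elim (use e(2) c1 in \<open>auto simp: f_def c_def\<close>)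
    moreover have f_eq: "f = (\<lambda>t. \<Sum>i\<in>UNIV. (x i * cos t + y i * sin t) ^ (k + 2))"
      by (auto simp: f_def power_sum_def c_def inner_add_right x_def y_def mult.commute)
    have "(f has_real_derivative f' t) (at t)" for t
      unfolding f_eq f'_def
      by (auto intro!: derivative_eq_intros sum.cong simp del: power_Suc)
    moreover have "(f' has_real_derivative D) (at 0)"
      unfolding f'_def D_def
      by (intro DERIV_sum) (rule derivative_eq_intros refl | simp add: algebra_simps power2_eq_square)+
    ultimately have "f' 0 = 0" "D \<le> 0"
      using local_max_derivative_conditions[of f f' D] by auto
    moreover have "f' 0 = real (k + 2) * (\<Sum>i\<in>UNIV. x i ^ (k + 1) * y i)"
      by (simp add: f'_def sum_distrib_left mult.assoc)
    moreover have "D = real (k + 2) * ((\<Sum>i\<in>UNIV. real (k + 1) * x i ^ k * (y i)\<^sup>2) - power_sum (k + 2) v)"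
      unfolding D_def power_sum_def x_def[symmetric] by (simp only: sum_subtractf flip: sum_distrib_left)
    ultimately show ?thesis
      unfolding x_def y_def by (auto simp: mult_le_0_iff)
  qed
  have "(\<Sum>i\<in>UNIV. (w i \<bullet> v) ^ (k + 1) * (w i \<bullet> u)) = 0 \<and>
    (\<Sum>i\<in>UNIV. real (k + 1) * (w i \<bullet> v) ^ k * (w i \<bullet> u)\<^sup>2) \<le> power_sum (k + 2) v * (u \<bullet> u)"
  proof (cases "u = 0")
    case False
    define z where "z = u /\<^sub>R norm u"
    have uz: "w i \<bullet> u = norm u * (w i \<bullet> z)" for i
      using False by (simp add: z_def)
    have z: "z \<bullet> v = 0" "norm z = 1"
      using False u by (simp_all add: z_def)
    have "(\<Sum>i\<in>UNIV. (w i \<bullet> v) ^ (k + 1) * (w i \<bullet> u))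
        = norm u * (\<Sum>i\<in>UNIV. (w i \<bullet> v) ^ (k + 1) * (w i \<bullet> z))"
      by (simp add: uz sum_distrib_left mult_ac)
    moreover have "(\<Sum>i\<in>UNIV. real (k + 1) * (w i \<bullet> v) ^ k * (w i \<bullet> u)\<^sup>2)
        = (u \<bullet> u) * (\<Sum>i\<in>UNIV. real (k + 1) * (w i \<bullet> v) ^ k * (w i \<bullet> z)\<^sup>2)"
      unfolding uz power_mult_distrib power2_norm_eq_inner by (simp add: sum_distrib_left mult_ac)
    ultimately show ?thesis
      using *[OF z] by (simp add: mult.commute mult_left_mono)
  qed simp
  then show "(\<Sum>i\<in>UNIV. (w i \<bullet> v) ^ (k + 1) * (w i \<bullet> u)) = 0"
    "(\<Sum>i\<in>UNIV. real (k + 1) * (w i \<bullet> v) ^ k * (w i \<bullet> u)\<^sup>2) \<le> power_sum (k + 2) v * (u \<bullet> u)"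
    by auto
qed

text \<open>The tangential part \<open>r\<close> of the gradient direction \<open>G\<close> is
  itself an admissible test direction, so it is orthogonal to itself.\<close>

lemma power_sum_local_max_eigenvector:
  assumes max: "local_maximizer_on (sphere 0 1) (power_sum (k + 2)) v"
  shows "(\<Sum>i\<in>UNIV. (w i \<bullet> v) ^ (k + 1) *\<^sub>R w i) = power_sum (k + 2) v *\<^sub>R v"
proof -
  define G where "G = (\<Sum>i\<in>UNIV. (w i \<bullet> v) ^ (k + 1) *\<^sub>R w i)"
  define r where "r = G - (G \<bullet> v) *\<^sub>R v"
  have v: "v \<bullet> v = 1"
    using max by (simp add: local_maximizer_on_def norm_eq_1)
  have Gv: "G \<bullet> v = power_sum (k + 2) v"
    by (simp add: G_def power_sum_def inner_sum_left mult.commute)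
  have r: "r \<bullet> v = 0"
    by (simp add: r_def inner_diff_left v)
  have "G \<bullet> r = 0"
    using power_sum_tangent_conditions(1)[OF max r] by (simp add: G_def inner_sum_left)
  then have "r \<bullet> r = 0"
    using r by (simp add: r_def inner_diff_left inner_commute)
  then show ?thesis
    using Gv by (simp add: r_def G_def)
qed

lemma power_sum_local_max:
  assumes max: "local_maximizer_on (sphere 0 1) (power_sum (k + 2)) v"
    and k: "1 \<le> k" "\<not> (k = 2 \<and> CARD('n) = 3)"
  shows "\<exists>i. v = w i \<or> (even k \<and> v = - w i)"
proof -
  define x where "x i = w i \<bullet> v" for i
  \<comment> \<open>\<open>a\<close> and \<open>b\<close> result from solving the
    \<open>j\<close>-th coordinate of the eigenvector equation for
    \<open>x j ^ (k + 1)\<close>.\<close>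
  define a where "a = (real CARD('n) - 1) / real CARD('n) * power_sum (k + 2) v"
  define b where "b = (\<Sum>i\<in>UNIV. x i ^ (k + 1)) / real CARD('n)"
  have v: "v \<bullet> v = 1" "norm v = 1"
    using max by (auto simp: local_maximizer_on_def norm_eq_1)
  have root: "x j ^ (k + 1) = a * x j + b" for j
  proof -
    have "(real CARD('n) * x j ^ (k + 1) - (\<Sum>i\<in>UNIV. x i ^ (k + 1))) / (real CARD('n) - 1) = power_sum (k + 2) v * x j"
      using inner_combination[of j "\<lambda>i. x i ^ (k + 1)"] power_sum_local_max_eigenvector[OF max]
      by (simp add: x_def)
    then show ?thesis
      using N_ge unfolding a_def b_def by (simp add: field_simps del: power_Suc)
  qed
  have hess: "(\<Sum>i\<in>UNIV. (real (k + 1) * x i ^ k - a) * (y i)\<^sup>2) \<le> 0"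
    if y: "sum y UNIV = 0" "(\<Sum>i\<in>UNIV. x i * y i) = 0" for y
  proof -
    define u where "u = ((real CARD('n) - 1) / real CARD('n)) *\<^sub>R (\<Sum>i\<in>UNIV. y i *\<^sub>R w i)"
    have wu: "w j \<bullet> u = y j" for j
      using N_ge y(1) by (simp add: u_def inner_combination)
    have "u \<bullet> v = 0"
      using y(2) by (simp add: u_def inner_sum_left x_def mult.commute)
    from power_sum_tangent_conditions(2)[OF max this]
    have "(\<Sum>i\<in>UNIV. real (k + 1) * x i ^ k * (y i)\<^sup>2) \<le> power_sum (k + 2) v * (u \<bullet> u)"
      by (simp add: wu x_def)
    \<comment> \<open>Tightness expresses \<open>u \<bullet> u\<close> through the coordinates
      \<open>y\<close> and so turns the eigenvalue into \<open>a\<close>.\<close>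
    also have "power_sum (k + 2) v * (u \<bullet> u) = a * (\<Sum>i\<in>UNIV. (y i)\<^sup>2)"
      using sum_inner_w_sq[of u] N_ge by (simp add: wu a_def)
    finally show ?thesis
      by (simp add: left_diff_distrib sum_subtractf sum_distrib_left)
  qed
  have "\<exists>i. x i = 1 \<or> (even k \<and> x i = -1)"
    using second_order_critical_values[OF card_ge k _ _ root hess] sum_inner_w[of v]
      sum_inner_w_sq[of v] v by (simp add: x_def)
  moreover have "v = w i" if "x i = 1" for i
    using norm_cauchy_schwarz_eq[of "w i" v] that by (simp add: x_def norm_w v)
  moreover have "v = - w i" if "x i = -1" for i
    using norm_cauchy_schwarz_eq[of "- w i" v] that by (simp add: x_def norm_w v)
  ultimately show ?thesis
    by blast
qed

lemma power_sum_uminus: "even m \<Longrightarrow> power_sum m (- v) = power_sum m v"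
  by (simp add: power_sum_def)

lemma w_local_max:
  assumes k: "1 \<le> k" "\<not> (k = 2 \<and> CARD('n) = 3)"
  shows "local_maximizer_on (sphere 0 1) (power_sum (k + 2)) (w i)"
proof -
  have "continuous_on (sphere 0 1) (power_sum (k + 2))"
    unfolding power_sum_def by (intro continuous_intros)
  then obtain v where v: "v \<in> sphere 0 1"
    "\<And>y. y \<in> sphere 0 1 \<Longrightarrow> power_sum (k + 2) y \<le> power_sum (k + 2) v"
    using continuous_attains_sup[OF compact_sphere, of 0 1 "power_sum (k + 2)"] norm_w
    by (metis empty_iff mem_sphere_0)
  then have "local_maximizer_on (sphere 0 1) (power_sum (k + 2)) v"
    unfolding local_maximizer_on_def using zero_less_one by blast
  from power_sum_local_max[OF this k] obtain j where "v = w j \<or> (even k \<and> v = - w j)"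
    by blast
  then have "power_sum (k + 2) v = power_sum (k + 2) (w i)"
    using power_sum_uminus[of "k + 2" "w j"] by (auto simp: power_sum_w)
  with v(2) norm_w show ?thesis
    unfolding local_maximizer_on_def by (auto intro!: exI[of _ 1])
qed

end

section \<open>From the matrix and its tensor to the frame\<close>

lemma regular_simplex_frame_imp_simplex_frame:
  fixes W :: "real ^ ('n::finite) ^ ('d::finite)"
  assumes W: "regular_simplex_frame W" and "3 \<le> CARD('n)"
  shows "simplex_frame (\<lambda>i. column i W)"
proof
  let ?N = "real CARD('n)"
  show "3 \<le> CARD('n)" by fact
  show "column i W \<bullet> column j W = (if i = j then 1 else - 1 / (?N - 1))" for i j
    using W by (simp add: regular_simplex_frame_def norm_eq_1)
  fix u v :: "real ^ 'd"
  have col: "column i W \<bullet> z = (transpose W *v z) $ i" for i z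
    by (simp add: matrix_vector_mult_def transpose_def column_def inner_vec_def)
  have "(\<Sum>i\<in>UNIV. (column i W \<bullet> u) * (column i W \<bullet> v)) = (transpose W *v u) \<bullet> (transpose W *v v)"
    unfolding inner_vec_def[of "transpose W *v u"] col by simp
  also have "\<dots> = u \<bullet> ((W ** transpose W) *v v)"
    by (simp add: dot_lmul_matrix flip: matrix_vector_mul_assoc)
  also have "W ** transpose W = (?N / (?N - 1)) *\<^sub>R mat 1"
    using W by (simp add: regular_simplex_frame_def)
  finally show "(\<Sum>i\<in>UNIV. (column i W \<bullet> u) * (column i W \<bullet> v)) = ?N / (?N - 1) * (u \<bullet> v)"
    by (simp add: scaleR_matrix_vector_assoc[symmetric])
qed

theorem theorem18:
  fixes W :: "real ^ ('n::finite) ^ ('d::finite)" and m n :: nat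
  assumes "CARD('n) = n"
    and "3 \<le> n" and "3 \<le> m"
    and "regular_simplex_frame W"
    and "(m, n) \<noteq> (4, 3)"
  shows "locally_maximized_eigenpairs m (simplex_tensor m W) // sign_equivalence m =
    {(tensor_form m (simplex_tensor m W) (column i W), column i W) | i. True} // sign_equivalence m"
proof -
  \<comment> \<open>With this shift the exponents \<open>k\<close>, \<open>k + 1\<close>,
    \<open>k + 2\<close> avoid truncated subtraction.\<close>
  define k where "k = m - 2"
  have k: "m = k + 2" "1 \<le> k" "\<not> (k = 2 \<and> CARD('n) = 3)" "m - 1 = k + 1"
    using assms by (auto simp: k_def)
  interpret simplex_frame "\<lambda>i. column i W"
    using regular_simplex_frame_imp_simplex_frame assms by blast
  note max_w = w_local_max[OF k(2,3), folded k(1)]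
    and eigenvector = power_sum_local_max_eigenvector[of k, folded k(1,4)]
    and local_max = power_sum_local_max[of k, folded k(1), OF _ k(2,3)]
  have form: "tensor_form m (simplex_tensor m W) = power_sum m"
    by (auto simp: tensor_form_simplex_tensor power_sum_def)
  have contract: "tensor_contract m (simplex_tensor m W) v
      = (\<Sum>i\<in>UNIV. (column i W \<bullet> v) ^ (m - 1) *\<^sub>R column i W)" for v
    using tensor_contract_simplex_tensor[of m W v] assms(3) by simp
  define L where "L = locally_maximized_eigenpairs m (simplex_tensor m W)"
  define B where "B = {(power_sum m (column i W), column i W) | i. True}"
  have L: "(l, v) \<in> L \<longleftrightarrow> (\<Sum>i\<in>UNIV. (column i W \<bullet> v) ^ (m - 1) *\<^sub>R column i W) = l *\<^sub>R v
      \<and> v \<bullet> v = 1 \<and> 0 \<le> l \<and> local_maximizer_on (sphere 0 1) (power_sum m) v" for l v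
    by (simp add: L_def locally_maximized_eigenpairs_def eigenpair_def form contract)
  have "B \<subseteq> L"
  proof -
    have "column i W \<bullet> column i W = 1" for i
      by (simp add: inner_w)
    then have "(power_sum m (column i W), column i W) \<in> L" for i
      unfolding L using eigenvector[OF max_w] power_sum_w_nonneg max_w assms(3) by simp
    then show ?thesis
      by (auto simp: B_def)
  qed
  \<comment> \<open>For even \<open>m\<close> the set \<open>L\<close> also contains the pairs with
    \<open>- column i W\<close>, so its members are only equivalent to members of
    \<open>B\<close>.\<close>
  moreover have "\<exists>q\<in>B. (p, q) \<in> sign_equivalence m" if "p \<in> L" for p
  proof -
    obtain l v where p: "p = (l, v)"
      by fastforce
    have max: "local_maximizer_on (sphere 0 1) (power_sum m) v"
      and lv: "(\<Sum>i\<in>UNIV. (column i W \<bullet> v) ^ (m - 1) *\<^sub>R column i W) = l *\<^sub>R v" "v \<bullet> v = 1"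
      using that by (auto simp: p L)
    have "v \<noteq> 0"
      using lv(2) by auto
    then have l: "l = power_sum m v"
      using eigenvector[OF max] lv(1) by simp
    from local_max[OF max] obtain i where "v = column i W \<or> (even k \<and> v = - column i W)"
      by blast
    then have "(p, (power_sum m (column i W), column i W)) \<in> sign_equivalence m"
      using power_sum_uminus[of m "column i W"] by (auto simp: sign_equivalence_def p l k(1))
    then show ?thesis
      by (auto simp: B_def)
  qed
  ultimately have "L // sign_equivalence m = B // sign_equivalence m"
    unfolding quotient_def using equiv_class_eq[OF equiv_sign_equivalence] by fast
  then show ?thesis
    by (simp add: L_def B_def form)
qed

end
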